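(* Let $\ell\ge 3$ be an integer, and let $G$ be a graph with no $5$-hole and no hole of length more than $\ell$. Then $$\chi(G)\le (2\ell-2)^{2^{\omega(G)}}.$$
   Context: All graphs are finite, without loops or parallel edges. A hole in $G$ is an induced subgraph which is a cycle of length (number of edges) at least four; an $n$-hole is a hole of length $n$. $\chi(G)$ is the chromatic number of $G$, and $\omega(G)$ is the size of the largest clique of $G$. *)

theory Defs
  imports "Graph_Theory.Digraph_Component" "Graph_Theory.Pair_Digraph"
begin

text \<open>
  Finite simple graphs are rendered by the locale \<^locale>\<open>pair_graph\<close>: finitely many vertices and a
  symmetric, irreflexive set of ordered pairs as arcs. An undirected edge \<open>uv\<close> is the pair of
  arcs \<open>(u, v)\<close> and \<open>(v, u)\<close>.
\<close>

text \<open>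
  For \<open>n \<ge> 3\<close> the graph below has \<open>n\<close> vertices and \<open>n\<close> undirected edges. The library's own
  \<open>pre_digraph.cycle\<close> is a predicate on closed walks that also admits \<open>a, b, a\<close>.
\<close>

definition is_cycle_graph :: "'a pair_pre_digraph \<Rightarrow> nat \<Rightarrow> bool" where
  "is_cycle_graph C n \<longleftrightarrow> n \<ge> 3 \<and>
     (\<exists>x :: nat \<Rightarrow> 'a. inj_on x {..<n} \<and> pverts C = x ` {..<n} \<and>
        parcs C = (\<Union>i<n. {(x i, x (Suc i mod n)), (x (Suc i mod n), x i)}))"

definition is_hole :: "'a pair_pre_digraph \<Rightarrow> 'a pair_pre_digraph \<Rightarrow> nat \<Rightarrow> bool" where
  "is_hole G H n \<longleftrightarrow>
     induced_subgraph (with_proj H) (with_proj G) \<and> is_cycle_graph H n \<and> n \<ge> 4"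

definition has_hole :: "'a pair_pre_digraph \<Rightarrow> nat \<Rightarrow> bool" where
  "has_hole G n \<longleftrightarrow> (\<exists>H. is_hole G H n)"

definition proper_coloring :: "'a pair_pre_digraph \<Rightarrow> nat \<Rightarrow> ('a \<Rightarrow> nat) \<Rightarrow> bool" where
  "proper_coloring G k c \<longleftrightarrow>
     (\<forall>v\<in>pverts G. c v < k) \<and> (\<forall>(u, v)\<in>parcs G. c u \<noteq> c v)"

definition chromatic_number :: "'a pair_pre_digraph \<Rightarrow> nat" where
  "chromatic_number G = (LEAST k. \<exists>c. proper_coloring G k c)"

definition is_clique :: "'a pair_pre_digraph \<Rightarrow> 'a set \<Rightarrow> bool" where
  "is_clique G K \<longleftrightarrow>
     K \<subseteq> pverts G \<and> (\<forall>u\<in>K. \<forall>v\<in>K. u \<noteq> v \<longrightarrow> (u, v) \<in> parcs G)"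

definition clique_number :: "'a pair_pre_digraph \<Rightarrow> nat" where
  "clique_number G = Max (card ` {K. is_clique G K})"

text \<open>The minimum and the maximum above are attained for every finite simple graph.\<close>

lemma (in pair_graph) chromatic_number_attained:
  "\<exists>c. proper_coloring G (chromatic_number G) c"
proof -
  obtain f :: "'a \<Rightarrow> nat" and n where f: "f ` pverts G = {i. i < n}" "inj_on f (pverts G)"
    using finite_imp_inj_to_nat_seg[OF pair_finite_verts] by blast
  have "f u \<noteq> f v" if "(u, v) \<in> parcs G" for u v
    using that f(2) arc_fst_in_verts[OF that] arc_snd_in_verts[OF that] pair_no_loops[OF that]
    by (auto dest: inj_onD)
  then have "proper_coloring G n f"
    using f(1) unfolding proper_coloring_def by blast
  then have "\<exists>k c. proper_coloring G k c"
    by blast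
  then show ?thesis
    unfolding chromatic_number_def by (rule LeastI_ex)
qed

lemma (in pair_graph) clique_number_attained:
  "\<exists>K. is_clique G K \<and> card K = clique_number G"
  "is_clique G K \<Longrightarrow> card K \<le> clique_number G"
proof -
  have fin: "finite {K. is_clique G K}"
    by (rule finite_subset[of _ "Pow (pverts G)"]) (auto simp: is_clique_def)
  have "is_clique G {}"
    by (simp add: is_clique_def)
  then have "clique_number G \<in> card ` {K. is_clique G K}"
    unfolding clique_number_def using fin by (intro Max_in) auto
  then show "\<exists>K. is_clique G K \<and> card K = clique_number G"
    by auto
  show "is_clique G K \<Longrightarrow> card K \<le> clique_number G"
    unfolding clique_number_def using fin by (intro Max_ge) auto
qed

end

theory Submission
  imports Defs
begin

text \<open>
  Induction on the clique number. Let \<open>g\<close> colours suffice for smaller cliques. Neighbourhoods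
  are \<open>g\<close>-colourable. Split the second neighbourhood of \<open>x\<close> according to a colour class of \<open>N(x)\<close>
  meeting the neighbourhood of the vertex. For adjacent vertices in one part, their neighbour sets in
  that stable class are comparable, since otherwise there is a 5-hole through \<open>x\<close>; so every clique
  in a part has a common neighbour, and balls of radius 2 are \<open>2g\<^sup>2\<close>-colourable.

  If all balls of radius 2 are \<open>T\<close>-colourable but some component \<open>C\<close> of a breadth-first level is
  not \<open>(2m + 1)T\<close>-colourable, where \<open>m = l - 3\<close>, grow an induced path (as Gyarfas does) from a parent
  \<open>q\<close> of \<open>C\<close> for \<open>m\<close> steps into \<open>C\<close>. What remains of \<open>C\<close> contains a vertex at distance at least 3 from
  the whole path. Extend the path towards it, leave \<open>C\<close> by its parent, and return to \<open>q\<close>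
  through earlier levels: this is a hole of length at least \<open>m + 4\<close>.
\<close>

section \<open>Colourings of vertex sets; an induced subgraph is just a subset\<close>

locale adjacency =
  fixes E :: "'a \<Rightarrow> 'a \<Rightarrow> bool"
  assumes sym: "E x y \<Longrightarrow> E y x"
    and irrefl: "\<not> E x x"
begin

definition colorable :: "'a set \<Rightarrow> nat \<Rightarrow> bool" where
  "colorable S k \<longleftrightarrow> (\<exists>c :: 'a \<Rightarrow> nat. (\<forall>v\<in>S. c v < k) \<and> (\<forall>u\<in>S. \<forall>v\<in>S. E u v \<longrightarrow> c u \<noteq> c v))"

lemma colorable_mono:
  assumes "colorable B k" "A \<subseteq> B" "k \<le> k'"
  shows "colorable A k'"
proof -
  obtain c where "\<forall>v\<in>B. c v < k" "\<forall>u\<in>B. \<forall>v\<in>B. E u v \<longrightarrow> c u \<noteq> (c v :: nat)"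
    using assms(1) unfolding colorable_def by blast
  then show ?thesis
    using assms(2,3) unfolding colorable_def by (intro exI[of _ c]) fastforce
qed

lemma colorable_Un:
  assumes "colorable A a" "colorable B b"
  shows "colorable (A \<union> B) (a + b)"
proof -
  obtain c where c: "\<And>v. v \<in> A \<Longrightarrow> c v < a" "\<And>u v. u \<in> A \<Longrightarrow> v \<in> A \<Longrightarrow> E u v \<Longrightarrow> c u \<noteq> c v"
    using assms(1) unfolding colorable_def by blast
  obtain d where d: "\<And>v. v \<in> B \<Longrightarrow> d v < b" "\<And>u v. u \<in> B \<Longrightarrow> v \<in> B \<Longrightarrow> E u v \<Longrightarrow> d u \<noteq> d v"
    using assms(2) unfolding colorable_def by blast
  show ?thesis
    unfolding colorable_def
  proof (intro exI[of _ "\<lambda>v. if v \<in> A then c v else a + d v"] conjI ballI impI)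
    fix v assume "v \<in> A \<union> B"
    then show "(if v \<in> A then c v else a + d v) < a + b"
      using c(1)[of v] d(1)[of v] by auto
  next
    fix u v assume "u \<in> A \<union> B" "v \<in> A \<union> B" "E u v"
    then show "(if u \<in> A then c u else a + d u) \<noteq> (if v \<in> A then c v else a + d v)"
      using c(1)[of v] c(1)[of u] c(2)[of u v] d(2)[of u v] by (auto split: if_splits)
  qed
qed

lemma colorable_empty: "colorable {} k"
  by (simp add: colorable_def)

lemma colorable_UN:
  assumes "finite I" "\<And>i. i \<in> I \<Longrightarrow> colorable (A i) k"
  shows "colorable (\<Union>i\<in>I. A i) (card I * k)"
  using assms
proof (induction I rule: finite_induct)
  case empty
  show ?case by (simp add: colorable_empty)
next
  case (insert i I)
  then show ?case
    using colorable_Un[of "A i" k "\<Union>i\<in>I. A i" "card I * k"] by simp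
qed

text \<open>No edge leaves a fibre of \<open>f\<close>, so colourings of the fibres can be chosen
  independently from one palette. Applied to components and to breadth-first levels of equal
  parity.\<close>

lemma colorable_fibres:
  assumes "\<And>u v. u \<in> S \<Longrightarrow> v \<in> S \<Longrightarrow> E u v \<Longrightarrow> f u = f v"
    and "\<And>u. u \<in> S \<Longrightarrow> colorable {v \<in> S. f v = f u} k"
  shows "colorable S k"
proof -
  have "\<forall>w\<in>S. \<exists>d :: 'a \<Rightarrow> nat. (\<forall>v\<in>{v \<in> S. f v = f w}. d v < k) \<and>
      (\<forall>u\<in>{v \<in> S. f v = f w}. \<forall>v\<in>{v \<in> S. f v = f w}. E u v \<longrightarrow> d u \<noteq> d v)"
    using assms(2) unfolding colorable_def by (rule ballI)
  from bchoice[OF this] obtain c :: "'a \<Rightarrow> 'a \<Rightarrow> nat"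
    where c: "\<And>w. w \<in> S \<Longrightarrow> (\<forall>v\<in>{v \<in> S. f v = f w}. c w v < k) \<and>
      (\<forall>u\<in>{v \<in> S. f v = f w}. \<forall>v\<in>{v \<in> S. f v = f w}. E u v \<longrightarrow> c w u \<noteq> c w v)"
    by (elim exE) blast
  \<comment> \<open>The representative depends on \<open>f v\<close> alone, so adjacent vertices are
    coloured by the same chosen colouring.\<close>
  define r where "r v = (SOME w. w \<in> S \<and> f w = f v)" for v
  have r: "r v \<in> S \<and> f (r v) = f v" if "v \<in> S" for v
    unfolding r_def by (rule someI[where x = v]) (use that in simp)
  have "c (r v) v < k" if "v \<in> S" for v
    using c[of "r v"] r[OF that] that by auto
  moreover have "c (r u) u \<noteq> c (r v) v" if "u \<in> S" "v \<in> S" "E u v" for u v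
  proof -
    have "r u = r v"
      using assms(1)[OF that] by (simp add: r_def)
    then show ?thesis
      using c[of "r v"] r[OF that(1)] r[OF that(2)] that by auto
  qed
  ultimately show ?thesis
    unfolding colorable_def by (intro exI[of _ "\<lambda>v. c (r v) v"]) blast
qed

section \<open>Connectivity inside a vertex set\<close>

text \<open>Reflexivity holds even for vertices outside \<open>S\<close>, which is why membership in
  \<open>S\<close> is asked for separately where it matters.\<close>

definition joined :: "'a set \<Rightarrow> 'a \<Rightarrow> 'a \<Rightarrow> bool" where
  "joined S = (\<lambda>u v. u \<in> S \<and> v \<in> S \<and> E u v)\<^sup>*\<^sup>*"

lemma joined_refl: "joined S u u"
  by (simp add: joined_def)

lemma joined_trans: "joined S u v \<Longrightarrow> joined S v w \<Longrightarrow> joined S u w"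
  unfolding joined_def by (rule rtranclp_trans)

lemma joined_edge: "u \<in> S \<Longrightarrow> v \<in> S \<Longrightarrow> E u v \<Longrightarrow> joined S u v"
  unfolding joined_def by blast

lemma joined_sym:
  assumes "joined S u v"
  shows "joined S v u"
  using assms unfolding joined_def
proof (induction rule: rtranclp_induct)
  case (step y z)
  show ?case
    by (rule converse_rtranclp_into_rtranclp[OF _ step.IH]) (use step(2) sym in auto)
qed simp

lemma joined_mono:
  assumes "joined S u v" "S \<subseteq> S'"
  shows "joined S' u v"
proof -
  have "(\<lambda>u v. u \<in> S \<and> v \<in> S \<and> E u v) \<le> (\<lambda>u v. u \<in> S' \<and> v \<in> S' \<and> E u v)"
    using assms(2) by auto
  from rtranclp_mono[OF this] show ?thesis
    using assms(1) unfolding joined_def by blast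
qed

definition component :: "'a set \<Rightarrow> 'a \<Rightarrow> 'a set" where
  "component S u = {v \<in> S. joined S u v}"

text \<open>A walk in \<open>S\<close> that starts at \<open>u\<close> never leaves the component of
  \<open>u\<close>, so the component is connected by itself and not merely through
  \<open>S\<close>.\<close>

lemma joined_component:
  assumes "a \<in> component S u" "b \<in> component S u"
  shows "joined (component S u) a b"
proof -
  have *: "joined (component S u) u b" if "joined S u b" "u \<in> S" for b
    using that(1) unfolding joined_def
  proof (induction rule: rtranclp_induct)
    case (step y z)
    then have "(\<lambda>u v. u \<in> S \<and> v \<in> S \<and> E u v)\<^sup>*\<^sup>* u z"
      by (intro rtranclp.rtrancl_into_rtrancl[OF step(1)]) auto
    then have "y \<in> component S u" "z \<in> component S u"
      using step(1,2) unfolding component_def joined_def by auto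
    then show ?case
      using step by (intro rtranclp.rtrancl_into_rtrancl[OF step.IH]) auto
  qed simp
  have "u \<in> S"
    using assms(1) unfolding component_def joined_def
    by (auto elim: converse_rtranclpE)
  then show ?thesis
    using * assms joined_sym joined_trans unfolding component_def by blast
qed

lemma colorable_components:
  assumes "\<And>u. u \<in> S \<Longrightarrow> colorable (component S u) k"
  shows "colorable S k"
proof (rule colorable_fibres[where f = "component S"])
  fix u v assume uv: "u \<in> S" "v \<in> S" "E u v"
  then have "joined S u v" "joined S v u"
    by (auto intro: joined_edge sym)
  then show "component S u = component S v"
    unfolding component_def by (auto intro: joined_trans)
next
  fix u assume "u \<in> S"
  have "{v \<in> S. component S v = component S u} \<subseteq> component S u"
    using joined_refl unfolding component_def by blast
  then show "colorable {v \<in> S. component S v = component S u} k"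
    by (rule colorable_mono[OF assms[OF \<open>u \<in> S\<close>]]) simp
qed

section \<open>Induced paths\<close>

text \<open>An induced path listed from one end. Each vertex is compared with later ones only, which
  suffices because \<open>E\<close> is symmetric.\<close>

fun ipath :: "'a list \<Rightarrow> bool" where
  "ipath [] \<longleftrightarrow> True"
| "ipath [x] \<longleftrightarrow> True"
| "ipath (x # y # zs) \<longleftrightarrow>
     x \<notin> set (y # zs) \<and> E x y \<and> (\<forall>z\<in>set zs. \<not> E x z) \<and> ipath (y # zs)"

lemma ipath_distinct: "ipath xs \<Longrightarrow> distinct xs"
  by (induction xs rule: ipath.induct) auto

lemma ipath_Cons:
  assumes "ys \<noteq> []"
  shows "ipath (x # ys) \<longleftrightarrow> x \<notin> set ys \<and> ipath ys \<and> (\<forall>y\<in>set ys. E x y \<longleftrightarrow> y = hd ys)"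
proof -
  obtain a zs where ys: "ys = a # zs"
    using assms by (cases ys) auto
  have "a \<notin> set zs" if "ipath ys"
    using ipath_distinct[OF that] ys by simp
  then have "(E x a \<and> (\<forall>z\<in>set zs. \<not> E x z)) \<longleftrightarrow> (\<forall>y\<in>set ys. E x y \<longleftrightarrow> y = a)" if "ipath ys"
    using that ys by (metis set_ConsD list.set_intros)
  then show ?thesis
    using ys by (metis ipath.simps(3) list.sel(1))
qed

text \<open>The gluing rule: two uses of it assemble the long hole from three induced paths.\<close>

lemma ipath_append:
  assumes "xs \<noteq> []" "ys \<noteq> []"
  shows "ipath (xs @ ys) \<longleftrightarrow> ipath xs \<and> ipath ys \<and> set xs \<inter> set ys = {} \<and>
     (\<forall>x\<in>set xs. \<forall>y\<in>set ys. E x y \<longleftrightarrow> x = last xs \<and> y = hd ys)"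
  using assms(1)
proof (induction xs)
  case (Cons x xs)
  show ?case
  proof (cases "xs = []")
    case True
    then show ?thesis
      using assms(2) by (auto simp: ipath_Cons)
  next
    case False
    let ?Q = "\<forall>y\<in>set (xs @ ys). E x y \<longleftrightarrow> y = hd (xs @ ys)"
    let ?Qx = "\<forall>y\<in>set xs. E x y \<longleftrightarrow> y = hd xs"
    let ?Qy = "\<forall>y\<in>set ys. E x y \<longleftrightarrow> x = last (x # xs) \<and> y = hd ys"
    let ?R = "\<forall>a\<in>set xs. \<forall>y\<in>set ys. E a y \<longleftrightarrow> a = last xs \<and> y = hd ys"
    \<comment> \<open>The head of \<open>xs @ ys\<close> is that of \<open>xs\<close> and lies
      outside \<open>ys\<close>, so \<open>x\<close> may have no neighbour in \<open>ys\<close> at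
      all.\<close>
    have "?Q \<longleftrightarrow> ?Qx \<and> ?Qy" if "x \<notin> set xs" "set xs \<inter> set ys = {}"
    proof -
      have "x \<noteq> last (x # xs)" "hd (xs @ ys) = hd xs" "\<And>y. y \<in> set ys \<Longrightarrow> y \<noteq> hd xs"
        using that False hd_in_set[OF False] by (auto simp: disjoint_iff)
      then show ?thesis
        unfolding set_append ball_Un
        by (intro arg_cong2[of _ _ _ _ "(\<and>)"] ball_cong refl) auto
    qed
    then have Q: "x \<notin> set xs \<longrightarrow> set xs \<inter> set ys = {} \<longrightarrow> (?Q \<longleftrightarrow> ?Qx \<and> ?Qy)"
      by (intro impI)
    have R: "(\<forall>a\<in>set (x # xs). \<forall>y\<in>set ys. E a y \<longleftrightarrow> a = last (x # xs) \<and> y = hd ys) \<longleftrightarrow> ?Qy \<and> ?R"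
      using False by simp
    have disj: "set (x # xs) \<inter> set ys = {} \<longleftrightarrow> x \<notin> set ys \<and> set xs \<inter> set ys = {}"
      by auto
    have ne: "xs @ ys \<noteq> []" using False by simp
    have "ipath ((x # xs) @ ys) \<longleftrightarrow> x \<notin> set xs \<and> x \<notin> set ys \<and> ipath (xs @ ys) \<and> ?Q"
      unfolding append_Cons ipath_Cons[OF ne]
      by (simp only: set_append Un_iff de_Morgan_disj conj_assoc)
    then show ?thesis
      using Q Cons.IH[OF False] unfolding ipath_Cons[OF False] R disj by argo
  qed
qed simp

lemma ipath_suffix: "ipath (xs @ ys) \<Longrightarrow> ipath ys"
  by (cases "xs = []"; cases "ys = []") (auto simp: ipath_append)

lemma ipath_nth:
  assumes "ipath xs" "i < j" "j < length xs"
  shows "E (xs ! i) (xs ! j) \<longleftrightarrow> j = Suc i"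
  using assms
proof (induction xs arbitrary: i j)
  case (Cons x xs)
  then obtain j' where j: "j = Suc j'" by (cases j) auto
  have ne: "xs \<noteq> []" using Cons by auto
  show ?case
  proof (cases i)
    case 0
    have "xs ! j' = hd xs \<longleftrightarrow> j' = 0"
      using ne Cons.prems j ipath_distinct[of "x # xs"] by (auto simp: hd_conv_nth nth_eq_iff_index_eq)
    then show ?thesis
      using Cons.prems 0 j ne by (auto simp: ipath_Cons)
  next
    case (Suc i')
    then show ?thesis
      using Cons.prems j ne Cons.IH[of i' j'] by (auto simp: ipath_Cons)
  qed
qed simp

text \<open>Prepending \<open>x\<close> may create chords. If \<open>x\<close> is on the path, the
  suffix after it does; if \<open>x\<close> has a neighbour beyond the head, the part before that
  neighbour is dropped and the argument repeats on a shorter path.\<close>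

lemma ipath_extend:
  assumes "ipath xs" "xs \<noteq> []" "E x (hd xs)"
  shows "\<exists>ys. ipath (x # ys) \<and> set ys \<subseteq> set xs \<and> last (x # ys) = last xs"
  using assms
proof (induction "length xs" arbitrary: xs rule: less_induct)
  case less
  show ?case
  proof (cases "x \<in> set xs")
    case True
    then obtain as bs where xs: "xs = as @ x # bs"
      by (meson split_list)
    then show ?thesis
      using less.prems ipath_suffix[of as "x # bs"] by (intro exI[of _ bs]) auto
  next
    case False
    show ?thesis
    proof (cases "\<exists>y\<in>set (tl xs). E x y")
      case True
      then obtain y where y: "y \<in> set (tl xs)" "E x y" by blast
      obtain a zs where a: "xs = a # zs" using less.prems(2) by (cases xs) auto
      obtain as bs where "zs = as @ y # bs"
        using y a by (metis list.sel(3) split_list)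
      then have xs: "xs = (a # as) @ y # bs" using a by simp
      obtain ys where "ipath (x # ys)" "set ys \<subseteq> set (y # bs)" "last (x # ys) = last (y # bs)"
        using less.hyps[of "y # bs"] xs y less.prems ipath_suffix[of "a # as" "y # bs"] by auto
      then show ?thesis
        using xs by (intro exI[of _ ys]) auto
    next
      case no: False
      have "ipath (x # xs)"
        using less.prems False no by (cases xs) (auto simp: ipath_Cons)
      then show ?thesis
        using less.prems by (intro exI[of _ xs]) auto
    qed
  qed
qed

lemma joined_ipath:
  assumes "joined S u v" "u \<in> S"
  shows "\<exists>xs. ipath xs \<and> xs \<noteq> [] \<and> hd xs = u \<and> last xs = v \<and> set xs \<subseteq> S"
  using assms unfolding joined_def
proof (induction rule: converse_rtranclp_induct)
  case base
  then show ?case by (intro exI[of _ "[v]"]) auto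
next
  case (step y z)
  then obtain xs where xs: "ipath xs" "xs \<noteq> []" "hd xs = z" "last xs = v" "set xs \<subseteq> S"
    by auto
  then obtain ys where "ipath (y # ys)" "set ys \<subseteq> set xs" "last (y # ys) = last xs"
    using ipath_extend[of xs y] step by auto
  then show ?case
    using xs step by (intro exI[of _ "y # ys"]) auto
qed

text \<open>Supplies two arcs of the long hole. Nonadjacent ends force an interior vertex on each,
  which the length count relies on.\<close>

lemma joined_ipath_interior:
  assumes "joined S u v" "u \<in> S" "u \<noteq> v" "\<not> E u v"
  obtains ms where "ms \<noteq> []" "ipath (u # ms @ [v])" "set ms \<subseteq> S - {u, v}"
proof -
  obtain xs where xs: "ipath xs" "xs \<noteq> []" "hd xs = u" "last xs = v" "set xs \<subseteq> S"
    using joined_ipath[OF assms(1,2)] by blast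
  obtain zs where zs: "xs = u # zs" using xs by (cases xs) auto
  then have "zs \<noteq> []" using xs assms(3) by auto
  then obtain ms where ms: "zs = ms @ [v]"
    using xs zs by (metis append_butlast_last_id last_ConsR)
  have eq: "xs = u # ms @ [v]" using zs ms by simp
  have "ms \<noteq> []" using xs eq assms(4) by auto
  moreover have "set ms \<subseteq> S - {u, v}"
    using xs(5) ipath_distinct[OF xs(1)] unfolding eq by auto
  ultimately show ?thesis
    using that[of ms] xs(1) unfolding eq by simp
qed

section \<open>Induced cycles\<close>

text \<open>A hole cut open at one vertex: the rest is an induced path whose two ends are the only
  neighbours of \<open>x\<close>. Three path vertices give length at least four.\<close>

definition icycle :: "'a list \<Rightarrow> bool" where
  "icycle zs \<longleftrightarrow> (\<exists>x xs. zs = x # xs \<and> length xs \<ge> 3 \<and> x \<notin> set xs \<and> ipath xs \<and>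
     (\<forall>y\<in>set xs. E x y \<longleftrightarrow> y = hd xs \<or> y = last xs))"

lemma icycle_distinct: "icycle zs \<Longrightarrow> distinct zs"
  unfolding icycle_def using ipath_distinct by auto

lemma icycle_nth:
  assumes "icycle zs" "i < j" "j < length zs"
  shows "E (zs ! i) (zs ! j) \<longleftrightarrow> j = Suc i \<or> (i = 0 \<and> Suc j = length zs)"
proof -
  obtain x xs where zs: "zs = x # xs" "length xs \<ge> 3" "ipath xs"
    "\<And>y. y \<in> set xs \<Longrightarrow> E x y \<longleftrightarrow> y = hd xs \<or> y = last xs"
    using assms(1) unfolding icycle_def by blast
  have ne: "xs \<noteq> []" using zs by auto
  obtain j' where j: "j = Suc j'" "j' < length xs" using assms zs by (cases j) auto
  show ?thesis
  proof (cases i)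
    case 0
    have "xs ! j' = hd xs \<longleftrightarrow> j' = 0" "xs ! j' = last xs \<longleftrightarrow> j' = length xs - 1"
      using ne j ipath_distinct[OF zs(3)] by (auto simp: hd_conv_nth last_conv_nth nth_eq_iff_index_eq)
    then show ?thesis
      using zs j 0 ne by auto
  next
    case (Suc i')
    then show ?thesis
      using zs j assms ipath_nth[OF zs(3), of i' j'] by auto
  qed
qed

section \<open>Colouring balls of radius 2\<close>

definition ball2 :: "'a set \<Rightarrow> 'a \<Rightarrow> 'a set" where
  "ball2 V x = {z \<in> V. z = x \<or> E x z \<or> (\<exists>y\<in>V. E x y \<and> E y z)}"

definition clique :: "'a set \<Rightarrow> bool" where
  "clique K \<longleftrightarrow> (\<forall>u\<in>K. \<forall>v\<in>K. u \<noteq> v \<longrightarrow> E u v)"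

text \<open>The assumption \<open>colorable_sub\<close> is the induction hypothesis on the clique
  number. The count is \<open>g\<close> colours for \<open>N\<close> and \<open>g\<close> for each
  of the \<open>g\<close> sets \<open>D i\<close>.\<close>

lemma colorable_ball2:
  assumes "finite V" "x \<in> V" "k \<ge> 1" "g \<ge> 1"
    and no_hole5: "\<And>zs. icycle zs \<Longrightarrow> set zs \<subseteq> V \<Longrightarrow> length zs \<noteq> 5"
    and colorable_sub: "\<And>S. S \<subseteq> V \<Longrightarrow> (\<And>K. K \<subseteq> S \<Longrightarrow> clique K \<Longrightarrow> card K \<le> k) \<Longrightarrow> colorable S g"
    and cliques: "\<And>K. K \<subseteq> V \<Longrightarrow> clique K \<Longrightarrow> card K \<le> Suc k"
  shows "colorable (ball2 V x) (2 * g\<^sup>2)"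
proof -
  define N where "N = {y \<in> V. E x y}"
  \<comment> \<open>A common neighbour enlarges the clique by one; this is how the bound drops from
    \<open>Suc k\<close> to \<open>k\<close>.\<close>
  have cone: "card K \<le> k" if K: "K \<subseteq> V" "clique K" and y: "y \<in> V" "\<And>z. z \<in> K \<Longrightarrow> E y z" for K y
  proof -
    have "y \<notin> K" using y irrefl by blast
    moreover have "finite K" using K assms(1) finite_subset by blast
    moreover have "clique (insert y K)"
      using K(2) y(2) sym unfolding clique_def by auto
    ultimately show ?thesis
      using cliques[of "insert y K"] K(1) y(1) by simp
  qed
  have N: "colorable N g"
    using cone[OF _ _ assms(2)] by (intro colorable_sub) (auto simp: N_def)
  then obtain c where c: "\<And>v. v \<in> N \<Longrightarrow> c v < g"
    "\<And>u v. u \<in> N \<Longrightarrow> v \<in> N \<Longrightarrow> E u v \<Longrightarrow> c u \<noteq> (c v :: nat)"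
    unfolding colorable_def by blast
  define A where "A i z = {y \<in> N. c y = i \<and> E y z}" for i z
  \<comment> \<open>The \<open>D i\<close> cover the second neighbourhood of \<open>x\<close> and may overlap.\<close>
  define D where "D i = {z \<in> V. z \<noteq> x \<and> z \<notin> N \<and> A i z \<noteq> {}}" for i
  have D_clique: "card K \<le> k" if K: "K \<subseteq> D i" "clique K" "K \<noteq> {}" for K i
  proof -
    \<comment> \<open>Choose \<open>z\<close> with fewest neighbours in colour class
      \<open>i\<close>; any such neighbour \<open>y\<close> will turn out to be adjacent to all of
      \<open>K\<close>.\<close>
    obtain z where z: "z \<in> K" "\<And>z'. z' \<in> K \<Longrightarrow> card (A i z) \<le> card (A i z')"
      using ex_has_least_nat[of "\<lambda>z. z \<in> K" _ "\<lambda>z. card (A i z)"] K(3) by blast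
    obtain y where y: "y \<in> A i z"
      using z(1) K(1) by (auto simp: D_def)
    have fin: "finite (A i z)" for z
      using assms(1) by (simp add: A_def N_def)
    have "E y z'" if z': "z' \<in> K" for z'
    proof (rule ccontr)
      assume nE: "\<not> E y z'"
      have zz': "E z z'"
        using z' z(1) K(2) y nE unfolding clique_def A_def by auto
      have "\<not> A i z' \<subseteq> A i z"
      proof
        assume "A i z' \<subseteq> A i z"
        then have "A i z' \<subset> A i z" using y nE by (auto simp: A_def)
        from psubset_card_mono[OF fin this] z(2)[OF z'] show False by simp
      qed
      then obtain y' where y': "y' \<in> A i z'" "\<not> E y' z"
        by (auto simp: A_def)
      have yN: "y \<in> N" "y' \<in> N" and cy: "c y = i" "c y' = i" and Ey: "E y z" "E z' y'"
        using y y' sym by (auto simp: A_def)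
      have zV: "z \<in> V" "z' \<in> V" "z \<noteq> x" "z' \<noteq> x" "z \<notin> N" "z' \<notin> N"
        using z(1) z' K(1) by (auto simp: D_def)
      have "E x y" "E x y'" "\<not> E x z" "\<not> E x z'" "y \<in> V" "y' \<in> V"
        using yN zV by (auto simp: N_def)
      moreover have "\<not> E y y'" using c(2) yN cy by metis
      moreover have "\<not> E z y'" using y'(2) sym by blast
      \<comment> \<open>All five chords are excluded: \<open>z\<close> and \<open>z'\<close> lie
        outside \<open>N\<close>, \<open>y\<close> misses \<open>z'\<close>, \<open>y'\<close>
        misses \<open>z\<close>, and \<open>y\<close>, \<open>y'\<close> share colour
        \<open>i\<close>.\<close>
      ultimately have "icycle [x, y, z, z', y']"
        unfolding icycle_def
        using zV yN Ey zz' nE y' irrefl by (intro exI[of _ x] exI[of _ "[y, z, z', y']"]) auto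
      then show False
        using no_hole5[of "[x, y, z, z', y']"] zV yN assms(2) by (auto simp: N_def)
    qed
    then show ?thesis
      using cone[of K y] K y by (auto simp: A_def N_def D_def)
  qed
  \<comment> \<open>Since \<open>x\<close> has no neighbour in \<open>D i\<close>, it can be added
    without raising the clique bound and costs no further colour.\<close>
  have D: "colorable (insert x (D i)) g" for i
  proof (rule colorable_sub)
    show "insert x (D i) \<subseteq> V" using assms(2) by (auto simp: D_def)
    fix K assume K: "K \<subseteq> insert x (D i)" "clique K"
    show "card K \<le> k"
    proof (cases "x \<in> K")
      case True
      then have "K = {x}"
        using K by (auto simp: clique_def D_def N_def)
      then show ?thesis using assms(3) by simp
    next
      case False
      then show ?thesis
        using K D_clique[of K i] by (cases "K = {}") auto
    qed
  qed
  have "colorable (\<Union>i<g. insert x (D i)) (g * g)"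
    using colorable_UN[of "{..<g}" "\<lambda>i. insert x (D i)" g] D by simp
  from colorable_Un[OF N this] show ?thesis
  proof (rule colorable_mono)
    show "g + g * g \<le> 2 * g\<^sup>2"
      using assms(4) by (simp add: power2_eq_square)
    show "ball2 V x \<subseteq> N \<union> (\<Union>i<g. insert x (D i))"
    proof
      fix z assume z: "z \<in> ball2 V x"
      show "z \<in> N \<union> (\<Union>i<g. insert x (D i))"
      proof (cases "z = x \<or> z \<in> N")
        case True
        moreover have "x \<in> (\<Union>i<g. insert x (D i))"
          using assms(4) by (intro UN_I[of 0]) auto
        ultimately show ?thesis by blast
      next
        case False
        then obtain y where y: "y \<in> N" "E y z"
          using z by (auto simp: ball2_def N_def)
        then have "z \<in> D (c y)"
          using z False by (auto simp: D_def A_def ball2_def)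
        then show ?thesis using c(1)[OF y(1)] by blast
      qed
    qed
  qed
qed

section \<open>Growing an induced path into a connected set\<close>

text \<open>The path grows at its head, so \<open>hd P\<close> is the only vertex of \<open>P\<close> with neighbours in \<open>C\<close>.\<close>

definition guided :: "'a list \<Rightarrow> 'a set \<Rightarrow> bool" where
  "guided P C \<longleftrightarrow> ipath P \<and> P \<noteq> [] \<and> set P \<inter> C = {} \<and>
     (\<forall>u\<in>C. \<forall>v\<in>C. joined C u v) \<and> (\<exists>w\<in>C. E (hd P) w) \<and> (\<forall>p\<in>set (tl P). \<forall>w\<in>C. \<not> E p w)"

lemma joined_crossing:
  assumes "joined S u v" "u \<notin> D" "v \<in> D"
  shows "\<exists>a\<in>S - D. \<exists>b\<in>S \<inter> D. E a b"
  using assms unfolding joined_def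
proof (induction rule: rtranclp_induct)
  case (step y z)
  then show ?case by (cases "y \<in> D") auto
qed simp

text \<open>Removing the neighbours of \<open>hd P\<close> costs \<open>T\<close> colours, so some
  component \<open>D\<close> of the remainder still needs more than \<open>r\<close>. Connectivity
  of \<open>C\<close> gives a vertex \<open>y\<close> outside \<open>D\<close> with a neighbour in
  \<open>D\<close>; it becomes the new head.\<close>

lemma guided_step:
  assumes "guided P C" "colorable {y \<in> C. E (hd P) y} T" "\<not> colorable C (T + r)"
  shows "\<exists>y\<in>C. \<exists>D\<subseteq>C. guided (y # P) D \<and> \<not> colorable D r"
proof -
  let ?N = "{y \<in> C. E (hd P) y}" and ?C = "{y \<in> C. \<not> E (hd P) y}"
  have "?N \<union> ?C = C" by auto
  then have "\<not> colorable ?C r"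
    using colorable_Un[OF assms(2), of ?C r] assms(3) by metis
  then obtain u where u: "u \<in> ?C" "\<not> colorable (component ?C u) r"
    using colorable_components by blast
  define D where "D = component ?C u"
  have D: "D \<subseteq> ?C" "u \<in> D"
    using u(1) joined_refl by (auto simp: D_def component_def)
  obtain w where w: "w \<in> C" "E (hd P) w"
    using assms(1) unfolding guided_def by blast
  have "joined C w u"
    using assms(1) w u(1) unfolding guided_def by blast
  moreover have "w \<notin> D" using w D by auto
  ultimately obtain y b where y: "y \<in> C" "y \<notin> D" and b: "b \<in> D" and yb: "E y b"
    using joined_crossing[of C w u D] D(2) by blast
  \<comment> \<open>Otherwise \<open>y\<close> would survive the removal and belong to the component
    \<open>D\<close>.\<close>
  have hy: "E (hd P) y"
  proof (rule ccontr)
    assume "\<not> E (hd P) y"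
    then have "joined ?C b y"
      using y b D yb by (intro joined_edge) (auto intro: sym)
    moreover have "joined ?C u b" using b by (simp add: D_def component_def)
    ultimately have "y \<in> D"
      using y \<open>\<not> E (hd P) y\<close> joined_trans by (auto simp: D_def component_def)
    then show False using y by blast
  qed
  have P: "ipath P" "P \<noteq> []" "set P \<inter> C = {}" "\<And>p w. p \<in> set (tl P) \<Longrightarrow> w \<in> C \<Longrightarrow> \<not> E p w"
    using assms(1) unfolding guided_def by auto
  obtain p ps where ps: "P = p # ps" using P(2) by (cases P) auto
  have "\<not> E y p'" if "p' \<in> set ps" for p'
    using P(4)[of p' y] that y(1) sym ps by auto
  then have "ipath (y # P)"
    using P y(1) hy sym ps by (auto simp: ipath_Cons)
  moreover have "\<not> E p w" if "p \<in> set P" "w \<in> D" for p w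
    using that P(4) D(1) ps by auto
  moreover have "set (y # P) \<inter> D = {}"
    using y(2) P(3) D(1) by auto
  moreover have "\<forall>u\<in>D. \<forall>v\<in>D. joined D u v"
    unfolding D_def using joined_component by blast
  ultimately have "guided (y # P) D"
    unfolding guided_def using yb b by auto
  then show ?thesis
    using y(1) D(1) u(2) unfolding D_def by (intro bexI[of _ y] exI[of _ D]) (auto simp: D_def)
qed

text \<open>Each of the \<open>i\<close> steps spends \<open>T\<close> colours. The bound on
  neighbourhoods covers \<open>C\<close> too, because later heads come from there.\<close>

lemma guided_extend:
  assumes "guided P C" "\<And>p. p \<in> set P \<union> C \<Longrightarrow> colorable {y \<in> C. E p y} T" "\<not> colorable C (i * T + r)"
  shows "\<exists>P' C'. guided P' C' \<and> length P' = length P + i \<and> last P' = last P \<and>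
    set P' \<subseteq> set P \<union> C \<and> C' \<subseteq> C \<and> \<not> colorable C' r"
  using assms
proof (induction i arbitrary: P C)
  case 0
  then show ?case by auto
next
  case (Suc i)
  have P: "P \<noteq> []" using Suc.prems(1) by (simp add: guided_def)
  obtain y D where D: "y \<in> C" "D \<subseteq> C" "guided (y # P) D" "\<not> colorable D (i * T + r)"
    using guided_step[OF Suc.prems(1) Suc.prems(2), of "i * T + r"] Suc.prems(3) P
    by (auto simp: add.assoc)
  have "colorable {y \<in> D. E p y} T" if "p \<in> set (y # P) \<union> D" for p
    using that D(1,2) by (intro colorable_mono[OF Suc.prems(2)[of p]]) auto
  from Suc.IH[OF D(3) this D(4)] obtain P' C' where "guided P' C'" "length P' = length (y # P) + i"
    "last P' = last (y # P)" "set P' \<subseteq> set (y # P) \<union> D" "C' \<subseteq> D" "\<not> colorable C' r"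
    by blast
  then show ?case
    using D(1,2) P by (intro exI[of _ P'] exI[of _ C']) auto
qed

section \<open>Breadth-first levels\<close>

text \<open>Following parents descends one level at a time, so all vertices after \<open>v\<close>
  lie strictly below its level. This keeps the return path away from level \<open>n\<close>.\<close>

lemma joined_root:
  assumes "\<And>v n. v \<in> V \<Longrightarrow> d v = Suc n \<Longrightarrow> \<exists>u\<in>V. E u v \<and> d u = n"
    and "\<And>v. v \<in> V \<Longrightarrow> d v = (0::nat) \<Longrightarrow> v = x"
    and "v \<in> V"
  shows "joined (insert v {w \<in> V. d w < d v}) v x"
  using assms(3)
proof (induction "d v" arbitrary: v)
  case 0
  then show ?case using assms(2)[of v] joined_refl by simp
next
  case (Suc n)
  then obtain u where u: "u \<in> V" "E u v" "d u = n"
    using assms(1)[of v n] by auto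
  have "joined (insert u {w \<in> V. d w < d u}) u x"
    using Suc(1)[of u] u by simp
  then have "joined (insert v {w \<in> V. d w < d v}) u x"
    by (rule joined_mono) (use u Suc(2) in auto)
  moreover have "joined (insert v {w \<in> V. d w < d v}) v u"
    using u Suc(2) sym by (intro joined_edge) auto
  ultimately show ?case using joined_trans by blast
qed

text \<open>The budget is \<open>m * T\<close> for growing the path by \<open>m\<close> steps and
  \<open>(m + 1) * T\<close> for the balls around its \<open>m + 1\<close> vertices.\<close>

lemma colorable_level:
  assumes adj: "\<And>u v. u \<in> V \<Longrightarrow> v \<in> V \<Longrightarrow> E u v \<Longrightarrow> d u \<le> Suc (d v)"
    and parent: "\<And>v n. v \<in> V \<Longrightarrow> d v = Suc n \<Longrightarrow> \<exists>u\<in>V. E u v \<and> d u = n"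
    and root: "\<And>v. v \<in> V \<Longrightarrow> d v = 0 \<Longrightarrow> v = x"
    and ball: "\<And>p. p \<in> V \<Longrightarrow> colorable (ball2 V p) T"
    and holes: "\<And>zs. icycle zs \<Longrightarrow> set zs \<subseteq> V \<Longrightarrow> length zs \<le> m + 3"
  shows "colorable {v \<in> V. d v = n} (m * T + (m + 1) * T)"
proof (cases n)
  case 0
  show ?thesis
  proof (cases "x \<in> V")
    case True
    have "{v \<in> V. d v = n} \<subseteq> ball2 V x"
      using root True 0 by (auto simp: ball2_def)
    from colorable_mono[OF ball[OF True] this] show ?thesis by simp
  next
    case False
    then have "{v \<in> V. d v = n} = {}" using root 0 by blast
    then show ?thesis by (simp only: colorable_empty)
  qed
next
  case n: (Suc n')
  define L where "L = {v \<in> V. d v = n}"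
  have "colorable (component L u) (m * T + (m + 1) * T)" if u: "u \<in> L" for u
  proof (rule ccontr)
    define C where "C = component L u"
    assume "\<not> colorable (component L u) (m * T + (m + 1) * T)"
    then have nC: "\<not> colorable C (m * T + (m + 1) * T)" by (simp add: C_def)
    have C: "C \<subseteq> L" "u \<in> C"
      using u joined_refl by (auto simp: C_def component_def)
    obtain q where q: "q \<in> V" "E q u" "d q = n'"
      using parent[of u n'] u n by (auto simp: L_def)
    have "guided [q] C"
      unfolding guided_def using C q n joined_component by (auto simp: L_def C_def)
    moreover have "colorable {y \<in> C. E p y} T" if "p \<in> set [q] \<union> C" for p
      using that q C by (intro colorable_mono[OF ball[of p]]) (auto simp: ball2_def L_def)
    ultimately obtain P C' where P: "guided P C'" "length P = m + 1" "last P = q"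
      "set P \<subseteq> insert q C" "C' \<subseteq> C" and nC': "\<not> colorable C' ((m + 1) * T)"
      using guided_extend[of "[q]" C T m "(m + 1) * T"] nC by auto
    have ip: "ipath P" "P \<noteq> []" "set P \<inter> C' = {}" "\<And>u v. u \<in> C' \<Longrightarrow> v \<in> C' \<Longrightarrow> joined C' u v"
      and hdP: "\<exists>w\<in>C'. E (hd P) w" and tlP: "\<And>p w. p \<in> set (tl P) \<Longrightarrow> w \<in> C' \<Longrightarrow> \<not> E p w"
      using P(1) unfolding guided_def by blast+
    have PV: "set P \<subseteq> V" using P(4) q C(1) by (auto simp: L_def)
    have dP: "d p = n" if "p \<in> set P" "p \<noteq> q" for p
      using that P(4) C(1) by (auto simp: L_def)
    have dC': "w \<in> V" "d w = n" if "w \<in> C'" for w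
      using that P(5) C(1) by (auto simp: L_def)
    \<comment> \<open>These balls are too cheap to cover \<open>C'\<close>, so some \<open>z\<close>
      in \<open>C'\<close> is at distance at least 3 from every vertex of \<open>P\<close>; hence
      its parent \<open>q'\<close> is neither on \<open>P\<close> nor adjacent to it.\<close>
    have "colorable (\<Union>p\<in>set P. ball2 V p) (card (set P) * T)"
      by (rule colorable_UN) (use ball PV in auto)
    moreover have "card (set P) = m + 1"
      using ipath_distinct[OF ip(1)] P(2) distinct_card by fastforce
    ultimately have "\<not> C' \<subseteq> (\<Union>p\<in>set P. ball2 V p)"
      using nC' colorable_mono by fastforce
    then obtain z where z: "z \<in> C'" "\<And>p. p \<in> set P \<Longrightarrow> z \<notin> ball2 V p" by blast
    obtain q' where q': "q' \<in> V" "E q' z" "d q' = n'"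
      using parent[of z n'] dC'[OF z(1)] n by auto
    have q'P: "q' \<notin> set P" "\<And>p. p \<in> set P \<Longrightarrow> \<not> E p q'"
      using z q' dC'[OF z(1)] by (auto simp: ball2_def)
    have qP: "q \<in> set P" using P(3) ip(2) last_in_set by metis
    have neq: "q \<noteq> q'" "\<not> E q q'" using q'P qP by auto
    obtain w where w: "w \<in> C'" "E (hd P) w" using hdP by blast
    let ?S = "insert q' (insert (hd P) C')"
    have "joined ?S q' z" "joined ?S w (hd P)"
      using w z q' sym by (auto intro!: joined_edge)
    moreover have "joined ?S z w"
      using ip(4)[OF z(1) w(1)] by (rule joined_mono) auto
    ultimately have "joined ?S q' (hd P)" using joined_trans by blast
    then obtain rs where rs: "rs \<noteq> []" "ipath (q' # rs @ [hd P])" "set rs \<subseteq> ?S - {q', hd P}"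
      using joined_ipath_interior[of ?S q' "hd P"] q'P ip(2) sym hd_in_set by (metis insertI1)
    then have rsC: "set rs \<subseteq> C'" by blast
    \<comment> \<open>Apart from \<open>q\<close> and \<open>q'\<close>, only levels below
      \<open>n'\<close> are allowed, so the interior \<open>us\<close> of the return path has no
      neighbour at level \<open>n\<close>.\<close>
    let ?U = "{q, q'} \<union> {w \<in> V. d w < n'}"
    have up: "joined ?U v x" if "v \<in> V" "d v = n'" "v \<in> ?U" for v
    proof (rule joined_mono)
      show "joined (insert v {w \<in> V. d w < d v}) v x"
        using parent root that(1) by (rule joined_root)
      show "insert v {w \<in> V. d w < d v} \<subseteq> ?U" using that(2,3) by auto
    qed
    have "joined ?U q x" "joined ?U q' x"
      by (intro up q q'; simp)+
    then have "joined ?U q q'" using joined_sym joined_trans by blast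
    then obtain us where us: "us \<noteq> []" "ipath (q # us @ [q'])" "set us \<subseteq> ?U - {q, q'}"
      using joined_ipath_interior[of ?U q q'] neq by blast
    have usV: "u \<in> V" "d u < n'" if "u \<in> set us" for u
      using that us(3) by auto
    \<comment> \<open>The hole cut open at \<open>q'\<close>: through \<open>C'\<close> to the head
      of \<open>P\<close>, down \<open>P\<close> to \<open>q\<close>, then back through earlier
      levels.\<close>
    let ?xs = "(rs @ P) @ us"
    have low: "\<not> E a b" if "a \<in> V" "d a = n" "b \<in> set us" for a b
      using adj[OF that(1) usV(1)[OF that(3)]] usV(2)[OF that(3)] that n by auto
    have 1: "ipath rs" "\<And>r. r \<in> set rs \<Longrightarrow> E r (hd P) \<longleftrightarrow> r = last rs"
      "\<And>r. r \<in> set rs \<Longrightarrow> E q' r \<longleftrightarrow> r = hd rs"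
    proof -
      have a: "ipath (rs @ [hd P])" "\<forall>y\<in>set (rs @ [hd P]). E q' y \<longleftrightarrow> y = hd (rs @ [hd P])"
        using rs(2) ipath_Cons[of "rs @ [hd P]" q'] by blast+
      show "ipath rs" "\<And>r. r \<in> set rs \<Longrightarrow> E r (hd P) \<longleftrightarrow> r = last rs"
        using a(1) ipath_append[OF rs(1), of "[hd P]"] by auto
      show "\<And>r. r \<in> set rs \<Longrightarrow> E q' r \<longleftrightarrow> r = hd rs"
        using a(2) rs(1) by simp
    qed
    have 2: "ipath us" "\<And>r. r \<in> set us \<Longrightarrow> E q r \<longleftrightarrow> r = hd us"
      "\<And>r. r \<in> set us \<Longrightarrow> E q' r \<longleftrightarrow> r = last us"
    proof -
      have a: "ipath (us @ [q'])" "\<forall>y\<in>set (us @ [q']). E q y \<longleftrightarrow> y = hd (us @ [q'])"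
        using us(2) ipath_Cons[of "us @ [q']" q] by blast+
      show "ipath us" using a(1) ipath_append[OF us(1), of "[q']"] by blast
      have "\<And>r. r \<in> set us \<Longrightarrow> E r q' \<longleftrightarrow> r = last us"
        using a(1) ipath_append[OF us(1), of "[q']"] by auto
      then show "\<And>r. r \<in> set us \<Longrightarrow> E q' r \<longleftrightarrow> r = last us"
        using sym by blast
      show "\<And>r. r \<in> set us \<Longrightarrow> E q r \<longleftrightarrow> r = hd us"
        using a(2) us(1) by simp
    qed
    have rsP: "ipath (rs @ P)"
    proof -
      have "E r p \<longleftrightarrow> r = last rs \<and> p = hd P" if "r \<in> set rs" "p \<in> set P" for r p
      proof (cases "p = hd P")
        case True
        then show ?thesis using 1(2)[OF that(1)] by simp
      next
        case False
        then have "p \<in> set (tl P)" using that(2) by (cases P) auto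
        then show ?thesis using tlP[of p r] that(1) rsC sym False by blast
      qed
      moreover have "set rs \<inter> set P = {}" using rsC ip(3) by blast
      ultimately show ?thesis
        using ipath_append[OF rs(1) ip(2)] 1(1) ip(1) by blast
    qed
    have ipxs: "ipath ?xs"
    proof -
      have l: "last (rs @ P) = q" using ip(2) P(3) by simp
      have "E a b \<longleftrightarrow> a = last (rs @ P) \<and> b = hd us" if "a \<in> set (rs @ P)" "b \<in> set us" for a b
      proof (cases "a = q")
        case True
        then show ?thesis using 2(2)[OF that(2)] l by simp
      next
        case False
        then have "a \<in> V" "d a = n"
          using that(1) dC' rsC dP PV by auto
        then show ?thesis using low[OF _ _ that(2)] False l by blast
      qed
      moreover have "set (rs @ P) \<inter> set us = {}"
      proof -
        have "n' \<le> d a" if "a \<in> set (rs @ P)" for a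
          using that dC'(2) rsC dP q(3) n by (cases "a = q") auto
        then show ?thesis using usV(2) by fastforce
      qed
      moreover have "rs @ P \<noteq> []" using rs(1) by simp
      ultimately show ?thesis
        using ipath_append[of "rs @ P" us] us(1) rsP 2(1) by blast
    qed
    have hl: "hd ?xs = hd rs" "last ?xs = last us" using rs(1) us(1) by auto
    have dist: "distinct ?xs" by (rule ipath_distinct[OF ipxs])
    have hlin: "hd rs \<in> set rs" "last us \<in> set us" using rs(1) us(1) by auto
    have q'xs: "E q' y \<longleftrightarrow> y = hd ?xs \<or> y = last ?xs" if y: "y \<in> set ?xs" for y
    proof -
      consider "y \<in> set rs" | "y \<in> set P" | "y \<in> set us" using y by auto
      then show ?thesis
      proof cases
        case 1
        moreover have "y \<noteq> last us" using 1 hlin(2) dist by auto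
        ultimately show ?thesis using hl \<open>\<And>r. r \<in> set rs \<Longrightarrow> E q' r \<longleftrightarrow> r = hd rs\<close> by simp
      next
        case 2
        moreover have "y \<noteq> last us" "y \<noteq> hd rs" using 2 hlin dist by auto
        ultimately show ?thesis using hl q'P(2)[OF 2] sym by blast
      next
        case 3
        moreover have "y \<noteq> hd rs" using 3 hlin(1) dist by auto
        ultimately show ?thesis using hl \<open>\<And>r. r \<in> set us \<Longrightarrow> E q' r \<longleftrightarrow> r = last us\<close> by simp
      qed
    qed
    have len: "length rs \<ge> 1" "length us \<ge> 1" "length P = m + 1"
      using rs(1) us(1) P(2) by (simp_all add: Suc_le_eq)
    have "q' \<notin> set ?xs" using rs(3) us(3) q'P(1) by auto
    then have "icycle (q' # ?xs)"
      unfolding icycle_def using ipxs q'xs len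
      by (intro exI[of _ q'] exI[of _ ?xs]) simp
    moreover have "set (q' # ?xs) \<subseteq> V" using q'(1) rsC dC' PV usV by auto
    \<comment> \<open>The length is at least 1 + 1 + (\<open>m\<close> + 1) + 1 = \<open>m\<close> +
      4, counting \<open>q'\<close>, \<open>rs\<close>, \<open>P\<close> and
      \<open>us\<close>.\<close>
    ultimately have "length (q' # ?xs) \<le> m + 3" by (rule holes)
    then show False using len by simp
  qed
  then show ?thesis
    using colorable_components unfolding L_def by blast
qed

section \<open>From balls to the whole graph\<close>

text \<open>In each component, edges join levels that differ by at most one. Levels of equal parity
  can therefore share a palette, and two palettes suffice.\<close>

lemma colorable_from_ball2:
  assumes ball: "\<And>p. p \<in> V \<Longrightarrow> colorable (ball2 V p) T"
    and holes: "\<And>zs. icycle zs \<Longrightarrow> set zs \<subseteq> V \<Longrightarrow> length zs \<le> m + 3"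
  shows "colorable V (2 * (m * T + (m + 1) * T))"
proof (rule colorable_components)
  fix x assume x: "x \<in> V"
  define R where "R = (\<lambda>u v. u \<in> V \<and> v \<in> V \<and> E u v)"
  define d where "d v = (LEAST n. (R ^^ n) x v)" for v
  define W where "W = component V x"
  have WV: "W \<subseteq> V" by (auto simp: W_def component_def)
  have d: "(R ^^ d v) x v" if "v \<in> W" for v
  proof -
    have "R\<^sup>*\<^sup>* x v" using that by (simp add: W_def component_def joined_def R_def)
    then show ?thesis
      unfolding d_def by (metis (mono_tags, lifting) LeastI rtranclp_power)
  qed
  have d_le: "d v \<le> n" if "(R ^^ n) x v" for n v
    unfolding d_def by (rule Least_le) (rule that)
  have adj: "d u \<le> Suc (d v)" if "u \<in> W" "v \<in> W" "E u v" for u v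
  proof (rule d_le)
    show "(R ^^ Suc (d v)) x u"
      using d[OF that(2)] that WV sym by (intro relpowp_Suc_I[of _ _ _ v]) (auto simp: R_def)
  qed
  have parent: "\<exists>u\<in>W. E u v \<and> d u = n" if v: "v \<in> W" "d v = Suc n" for v n
  proof -
    obtain u where u: "(R ^^ n) x u" "R u v"
      using d[OF v(1)] v(2) by (metis relpowp_Suc_E)
    have "u \<in> W"
      using relpowp_imp_rtranclp[OF u(1)] u(2) by (auto simp: W_def component_def joined_def R_def)
    moreover have "d u = n"
      using d_le[OF u(1)] adj[OF v(1) \<open>u \<in> W\<close>] u(2) v(2) sym by (auto simp: R_def)
    ultimately show ?thesis using u(2) by (auto simp: R_def)
  qed
  have root: "v = x" if "v \<in> W" "d v = 0" for v
    using d[OF that(1)] that(2) by simp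
  have ballW: "colorable (ball2 W p) T" if "p \<in> W" for p
    using that WV by (intro colorable_mono[OF ball[of p]]) (auto simp: ball2_def)
  have holesW: "length zs \<le> m + 3" if "icycle zs" "set zs \<subseteq> W" for zs
    using holes[OF that(1)] that(2) WV by blast
  let ?M = "m * T + (m + 1) * T"
  have level: "colorable {v \<in> W. d v = n} ?M" for n
    using adj parent root ballW holesW by (rule colorable_level)
  have parity: "colorable {v \<in> W. even (d v) = b} ?M" for b
  proof (rule colorable_fibres[where f = d])
    fix u v assume "u \<in> {v \<in> W. even (d v) = b}" "v \<in> {v \<in> W. even (d v) = b}" "E u v"
    moreover from this have "d u \<le> Suc (d v)" "d v \<le> Suc (d u)"
      using adj sym by auto
    ultimately show "d u = d v"
      by (cases "d u = Suc (d v) \<or> d v = Suc (d u)") auto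
  next
    fix u
    show "colorable {v \<in> {v \<in> W. even (d v) = b}. d v = d u} ?M"
      by (rule colorable_mono[OF level[of "d u"]]) auto
  qed
  have "colorable ({v \<in> W. even (d v) = True} \<union> {v \<in> W. even (d v) = False}) (?M + ?M)"
    using parity by (intro colorable_Un)
  then show "colorable (component V x) (2 * ?M)"
    by (rule colorable_mono) (auto simp: W_def)
qed

text \<open>The exponent e(k) = \<open>2 ^ Suc k - 2\<close> solves e(k+1) = 2 + 2 e(k) with e(0) =
  0: stable sets take one colour, and each step squares \<open>g\<close> and adds a factor of at
  most \<open>(2 * l - 2)\<^sup>2\<close>.\<close>

lemma colorable_of_clique_bound:
  assumes "finite V" "l \<ge> 3"
    and "\<And>zs. icycle zs \<Longrightarrow> set zs \<subseteq> V \<Longrightarrow> length zs \<noteq> 5"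
    and "\<And>zs. icycle zs \<Longrightarrow> set zs \<subseteq> V \<Longrightarrow> length zs \<le> l"
    and "\<And>K. K \<subseteq> V \<Longrightarrow> clique K \<Longrightarrow> card K \<le> Suc k"
  shows "colorable V ((2 * l - 2) ^ (2 ^ Suc k - 2))"
  using assms(1,3-)
proof (induction k arbitrary: V)
  case 0
  have "\<not> E u v" if "u \<in> V" "v \<in> V" for u v
  proof
    assume "E u v"
    then have "u \<noteq> v" using irrefl by blast
    then have "clique {u, v}" "card {u, v} = 2"
      using \<open>E u v\<close> sym by (auto simp: clique_def)
    then show False using "0.prems"(4)[of "{u, v}"] that by simp
  qed
  then show ?case
    unfolding colorable_def by (intro exI[of _ "\<lambda>_. 0"]) auto
next
  case (Suc k)
  define g where "g = (2 * l - 2) ^ (2 ^ Suc k - 2)"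
  have g: "g \<ge> 1" using assms(2) by (simp add: g_def)
  have sub: "colorable S g" if "S \<subseteq> V" "\<And>K. K \<subseteq> S \<Longrightarrow> clique K \<Longrightarrow> card K \<le> Suc k" for S
    unfolding g_def
  proof (rule Suc.IH)
    show "finite S" using that(1) Suc.prems(1) finite_subset by blast
  qed (use that Suc.prems in blast)+
  have "colorable (ball2 V p) (2 * g\<^sup>2)" if "p \<in> V" for p
    by (rule colorable_ball2[where k = "Suc k"]) (use Suc.prems sub g that in auto)
  moreover obtain m where m: "l = m + 3" using assms(2) by (metis le_add_diff_inverse2)
  ultimately have "colorable V (2 * (m * (2 * g\<^sup>2) + (m + 1) * (2 * g\<^sup>2)))"
    using colorable_from_ball2[of V "2 * g\<^sup>2" m] Suc.prems(3) by blast
  then show ?case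
  proof (rule colorable_mono)
    have "2 ^ Suc (Suc k) - 2 = 2 + 2 * (2 ^ Suc k - 2 :: nat)"
      using one_le_power[of "2::nat" k] unfolding power_Suc by linarith
    then have "(2 * l - 2) ^ (2 ^ Suc (Suc k) - 2) = (2 * l - 2)\<^sup>2 * g\<^sup>2"
      by (simp only: g_def power_add power_mult[symmetric] mult.commute[of _ 2])
    moreover have "2 * (m * (2 * g\<^sup>2) + (m + 1) * (2 * g\<^sup>2)) = (8 * m + 4) * g\<^sup>2"
      by (simp add: algebra_simps)
    \<comment> \<open>Here \<open>2 * l - 2\<close> equals \<open>2 * m + 4\<close>, with square
      4m^2 + 16m + 16.\<close>
    moreover have "8 * m + 4 \<le> (2 * l - 2)\<^sup>2"
      by (simp add: m power2_eq_square algebra_simps)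
    ultimately show "2 * (m * (2 * g\<^sup>2) + (m + 1) * (2 * g\<^sup>2)) \<le> (2 * l - 2) ^ (2 ^ Suc (Suc k) - 2)"
      by simp
  qed simp
qed

end

section \<open>Transfer to graphs and their holes\<close>

lemma (in pair_graph) adjacency: "adjacency (\<lambda>u v. (u, v) \<in> parcs G)"
  by unfold_locales (auto intro: arcs_symmetric dest: pair_no_loops)

text \<open>The subgraph induced on \<open>set zs\<close> is the hole, and indexing into
  \<open>zs\<close> is its cyclic enumeration.\<close>

lemma (in pair_graph) has_hole_icycle:
  assumes "adjacency.icycle (\<lambda>u v. (u, v) \<in> parcs G) zs" "set zs \<subseteq> pverts G"
  shows "has_hole G (length zs)"
proof -
  interpret adjacency "\<lambda>u v. (u, v) \<in> parcs G" by (rule adjacency)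
  let ?n = "length zs"
  define H where "H = \<lparr>pverts = set zs, parcs = parcs G \<inter> set zs \<times> set zs\<rparr>"
  have n: "?n \<ge> 4" using assms(1) unfolding icycle_def by auto
  have dist: "distinct zs" by (rule icycle_distinct[OF assms(1)])
  \<comment> \<open>Reduction modulo the length absorbs the closing edge, which
    \<open>icycle_nth\<close> lists as a separate case.\<close>
  have E: "(zs ! i, zs ! j) \<in> parcs G \<longleftrightarrow> j = Suc i mod ?n \<or> i = Suc j mod ?n"
    if ij: "i < ?n" "j < ?n" for i j
  proof -
    have *: "(zs ! i, zs ! j) \<in> parcs G \<longleftrightarrow> j = Suc i mod ?n \<or> i = Suc j mod ?n"
      if ij: "i < j" "j < ?n" for i j
      using icycle_nth[OF assms(1) ij] ij n by (cases "Suc j = ?n") auto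
    consider "i < j" | "j < i" | "i = j" by linarith
    then show ?thesis
    proof cases
      case 2
      then show ?thesis using *[of j i] ij sym by blast
    next
      case 3
      then show ?thesis using irrefl ij n by (cases "Suc i = ?n") auto
    qed (use * ij in blast)
  qed
  have "parcs H = (\<Union>i<?n. {(zs ! i, zs ! (Suc i mod ?n)), (zs ! (Suc i mod ?n), zs ! i)})"
  proof (intro equalityI subrelI)
    fix a b assume "(a, b) \<in> parcs H"
    then have "a \<in> set zs" "b \<in> set zs" "(a, b) \<in> parcs G"
      by (auto simp: H_def)
    moreover from this obtain i j where "i < ?n" "j < ?n" "a = zs ! i" "b = zs ! j"
      unfolding in_set_conv_nth by blast
    ultimately show "(a, b) \<in> (\<Union>i<?n. {(zs ! i, zs ! (Suc i mod ?n)), (zs ! (Suc i mod ?n), zs ! i)})"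
      using E[of i j] by auto
  next
    fix a b assume "(a, b) \<in> (\<Union>i<?n. {(zs ! i, zs ! (Suc i mod ?n)), (zs ! (Suc i mod ?n), zs ! i)})"
    then obtain i where i: "i < ?n" "(a, b) = (zs ! i, zs ! (Suc i mod ?n)) \<or> (a, b) = (zs ! (Suc i mod ?n), zs ! i)"
      by blast
    moreover have "Suc i mod ?n < ?n" using n by (intro mod_less_divisor) linarith
    ultimately show "(a, b) \<in> parcs H"
      using E[of i "Suc i mod ?n"] E[of "Suc i mod ?n" i] by (auto simp: H_def)
  qed
  moreover have "pverts H = (!) zs ` {..<?n}"
    by (auto simp: H_def in_set_conv_nth)
  moreover have "inj_on ((!) zs) {..<?n}"
    using dist by (auto simp: inj_on_def nth_eq_iff_index_eq)
  ultimately have "is_cycle_graph H ?n"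
    unfolding is_cycle_graph_def using n by (intro conjI exI[of _ "(!) zs"]) auto
  moreover have "induced_subgraph (with_proj H) (with_proj G)"
    unfolding induced_subgraph_def subgraph_def
    using assms(2) wf_digraph_axioms
    by (auto simp: H_def wf_digraph_wp_iff pair_wf_digraph_def)
  ultimately have "is_hole G H ?n"
    unfolding is_hole_def using n by blast
  then show ?thesis unfolding has_hole_def by blast
qed

theorem mainTheorem3:
  fixes G :: "'a pair_pre_digraph" and l :: nat
  assumes "l \<ge> 3"
    and "pair_graph G"
    and "\<not> has_hole G 5"
    and "\<And>n. n > l \<Longrightarrow> \<not> has_hole G n"
  shows "chromatic_number G \<le> (2 * l - 2) ^ (2 ^ clique_number G)"
proof -
  interpret pair_graph G by (rule assms(2))
  interpret adj: adjacency "\<lambda>u v. (u, v) \<in> parcs G" by (rule adjacency)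
  let ?w = "clique_number G"
  \<comment> \<open>Truncated subtraction lets the empty graph through: clique number 0 is treated
    as 1.\<close>
  let ?k = "(2 * l - 2) ^ (2 ^ Suc (?w - 1) - 2)"
  have "adj.colorable (pverts G) ?k"
  proof (rule adj.colorable_of_clique_bound)
    fix K assume "K \<subseteq> pverts G" "adj.clique K"
    then have "is_clique G K" by (simp add: is_clique_def adj.clique_def)
    from clique_number_attained(2)[OF this] show "card K \<le> Suc (?w - 1)" by simp
  next
    fix zs assume zs: "adj.icycle zs" "set zs \<subseteq> pverts G"
    show "length zs \<noteq> 5" using has_hole_icycle[OF zs] assms(3) by auto
    show "length zs \<le> l" using has_hole_icycle[OF zs] assms(4) by (meson not_le)
  qed (use assms(1) in auto)
  then obtain c where "\<forall>v\<in>pverts G. c v < ?k"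
    "\<forall>u\<in>pverts G. \<forall>v\<in>pverts G. (u, v) \<in> parcs G \<longrightarrow> c u \<noteq> (c v :: nat)"
    unfolding adj.colorable_def by blast
  then have "proper_coloring G ?k c"
    unfolding proper_coloring_def using arc_fst_in_verts arc_snd_in_verts by fastforce
  then have "chromatic_number G \<le> ?k"
    unfolding chromatic_number_def by (intro Least_le) blast
  also have "\<dots> \<le> (2 * l - 2) ^ (2 ^ ?w)"
  proof (rule power_increasing)
    show "2 ^ Suc (?w - 1) - 2 \<le> (2 ^ ?w :: nat)" by (cases ?w) auto
  qed (use assms(1) in simp)
  finally show ?thesis .
qed

end
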